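(* For every $a>0$ the following hold, where $p_+(t)$ and $q(t)$ are as in the context. (a) The lower boundary curve $x=p_+(t)$ is positive for $t<t^*=a/(a+1)$ and is zero for $t\ge t^*$. At $t=t^*$ it has continuous first and second order derivatives. (b) The upper boundary curve $x=q(t)$ has slope $q'(1)=-4$ at $t=1$, which is independent of the value of $a$. (c) The upper boundary curve $x=q(t)$ is concave if $a\le1$. It is not concave on the full interval $[0,1]$ if $a>1$. (d) The maximum of the upper boundary curve $x=q(t)$ is $a+1$.
   Context: For $t\in(0,1)$, $p(t)<q(t)$ denote the branch points, other than $0$ and $\infty$ (up to coincidence of $p$ with $0$ when $t=t^*$), of the Riemann surface of $z=\frac{1-k\zeta}{\zeta(1-t(1-t)\zeta)^2}$, $k=(1-t)(t-a(1-t))$. They are the two real solutions $x$ of $$4ax^2+x\big(t^2-20at(1-t)-8a^2(1-t)^2\big)-4(1-t)(t-a(1-t))^3=0,$$ and $q(t)>0$. One sets $p_+(t)=\max(0,p(t))$. The functions are extended to $t\in[0,1]$ by continuity (so $q(0)=a$, $q(1)=0$). *)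

theory Defs
  imports "HOL-Analysis.Analysis"
begin

definition kpar :: "real \<Rightarrow> real \<Rightarrow> real" where
  "kpar a t = (1 - t) * (t - a * (1 - t))"

definition zmap :: "real \<Rightarrow> real \<Rightarrow> complex \<Rightarrow> complex" where
  "zmap a t \<zeta> = (1 - of_real (kpar a t) * \<zeta>) / (\<zeta> * (1 - of_real (t * (1 - t)) * \<zeta>)\<^sup>2)"

text \<open>
  The Riemann surface of \<open>z = zmap a t \<zeta>\<close> is the \<open>\<zeta>\<close>-sphere, spread over the \<open>z\<close>-sphere by \<open>zmap a t\<close>;
  its branch points are the images of the ramification points, which away from the poles are the
  zeros of the derivative.  The poles \<open>\<zeta> = 0\<close> and \<open>\<zeta> = 1 / (t (1 - t))\<close> lie over \<open>\<infinity>\<close> and the point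
  \<open>\<zeta> = \<infinity>\<close> lies over \<open>0\<close>, so for the branch points other than \<open>0\<close> and \<open>\<infinity>\<close> they play no role.
\<close>
definition branch_points :: "real \<Rightarrow> real \<Rightarrow> complex set" where
  "branch_points a t =
     {zmap a t \<zeta> | \<zeta>. \<zeta> \<noteq> 0 \<and> 1 - of_real (t * (1 - t)) * \<zeta> \<noteq> 0 \<and> deriv (zmap a t) \<zeta> = 0} - {0}"

definition tstar :: "real \<Rightarrow> real" where
  "tstar a = a / (a + 1)"

text \<open>
  For \<open>t = tstar a\<close> one of the two branch points has moved into \<open>0\<close>; there \<open>0\<close> is added by hand.
\<close>
definition branch_xs :: "real \<Rightarrow> real \<Rightarrow> real set" where
  "branch_xs a t = {x. complex_of_real x \<in> branch_points a t} \<union> (if t = tstar a then {0} else {})"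

text \<open>Extension by continuity from \<open>(0, 1)\<close> to \<open>[0, 1]\<close>; the values outside \<open>[0, 1]\<close> are irrelevant.\<close>
definition extend01 :: "(real \<Rightarrow> real) \<Rightarrow> real \<Rightarrow> real" where
  "extend01 f t = (if t \<in> {0<..<1} then f t else Lim (at t within {0<..<1}) f)"

definition p_branch :: "real \<Rightarrow> real \<Rightarrow> real" where
  "p_branch a = extend01 (\<lambda>t. Min (branch_xs a t))"

definition q_branch :: "real \<Rightarrow> real \<Rightarrow> real" where
  "q_branch a = extend01 (\<lambda>t. Max (branch_xs a t))"

definition p_plus :: "real \<Rightarrow> real \<Rightarrow> real" where
  "p_plus a t = max 0 (p_branch a t)"

text \<open>
  The rest of this theory confirms that, for \<open>0 < t < 1\<close>, \<open>p_branch a t < q_branch a t\<close> are exactly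
  the complex solutions of the quadratic equation for the branch points.
\<close>
definition quad :: "real \<Rightarrow> real \<Rightarrow> complex \<Rightarrow> complex" where
  "quad a t x = of_real (4 * a) * x\<^sup>2
     + x * of_real (t\<^sup>2 - 20 * a * t * (1 - t) - 8 * a\<^sup>2 * (1 - t)\<^sup>2)
     - of_real (4 * (1 - t) * (t - a * (1 - t)) ^ 3)"

definition xval :: "real \<Rightarrow> real \<Rightarrow> real \<Rightarrow> real" where
  "xval a t w = (- (t\<^sup>2 - 20 * a * t * (1 - t) - 8 * a\<^sup>2 * (1 - t)\<^sup>2) + (t + 8 * a * (1 - t)) * w) / (8 * a)"

lemma quad_factor:
  assumes "a > 0" "w\<^sup>2 = t * (t + 8 * a * (1 - t))"
  shows "quad a t z = of_real (4 * a) * (z - of_real (xval a t w)) * (z - of_real (xval a t (- w)))"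
proof -
  let ?b = "t\<^sup>2 - 20 * a * t * (1 - t) - 8 * a\<^sup>2 * (1 - t)\<^sup>2"
  have sum: "4 * a * (xval a t w + xval a t (- w)) = - ?b"
    using assms(1) by (simp add: xval_def field_simps)
  have "16 * a * (4 * a * (xval a t w * xval a t (- w))) = ?b\<^sup>2 - (t + 8 * a * (1 - t))\<^sup>2 * w\<^sup>2"
    using assms(1) by (simp add: xval_def field_simps power2_eq_square)
  also have "\<dots> = 16 * a * (- (4 * (1 - t) * (t - a * (1 - t)) ^ 3))"
    unfolding assms(2) by algebra
  finally have *: "16 * a * (4 * a * (xval a t w * xval a t (- w))) = \<dots>" .
  have "16 * a \<noteq> 0" using assms(1) by simp
  from * mult_left_cancel[OF this]
  have prod: "4 * a * (xval a t w * xval a t (- w)) = - (4 * (1 - t) * (t - a * (1 - t)) ^ 3)"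
    by blast
  have "of_real (4 * a) * (z - of_real (xval a t w)) * (z - of_real (xval a t (- w)))
      = of_real (4 * a) * z\<^sup>2 - z * of_real (4 * a * (xval a t w + xval a t (- w)))
        + of_real (4 * a * (xval a t w * xval a t (- w)))"
    by (simp add: algebra_simps power2_eq_square)
  then show ?thesis
    unfolding sum prod quad_def
    by (simp only: of_real_minus mult_minus_right diff_minus_eq_add add_uminus_conv_diff)
qed

lemma xval_identity:
  assumes "a > 0" "0 < t" "w\<^sup>2 = t * (t + 8 * a * (1 - t))"
    and "u = (1 - t) * (3 * t + w) / 2"
  shows "xval a t w * (u - t * (1 - t))\<^sup>2 = (u - kpar a t) * u\<^sup>2"
    and "u\<^sup>2 - 3 * (t * (1 - t)) * u + 2 * (t * (1 - t)) * kpar a t = 0"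
proof -
  have "4 * (u\<^sup>2 - 3 * (t * (1 - t)) * u + 2 * (t * (1 - t)) * kpar a t) = 0"
    using assms(3) unfolding assms(4) kpar_def power_divide by (simp add: field_simps, algebra)
  then show "u\<^sup>2 - 3 * (t * (1 - t)) * u + 2 * (t * (1 - t)) * kpar a t = 0"
    by simp
  have U: "2 * u = (1 - t) * (3 * t + w)" using assms(4) by simp
  have X: "8 * a * xval a t w
      = - (t\<^sup>2 - 20 * a * t * (1 - t) - 8 * a\<^sup>2 * (1 - t)\<^sup>2) + (t + 8 * a * (1 - t)) * w"
    using assms(1) by (simp add: xval_def)
  have "64 * a * (xval a t w * (u - t * (1 - t))\<^sup>2) = 64 * a * ((u - kpar a t) * u\<^sup>2)"
  proof -
    have "64 * a * (xval a t w * (u - t * (1 - t))\<^sup>2)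
        = 2 * (8 * a * xval a t w) * (2 * u - 2 * (t * (1 - t)))\<^sup>2"
      by algebra
    also have "\<dots> = 8 * a * (2 * u - 2 * kpar a t) * (2 * u)\<^sup>2"
      unfolding X U kpar_def using assms(3) by algebra
    also have "\<dots> = 64 * a * ((u - kpar a t) * u\<^sup>2)"
      by algebra
    finally show ?thesis .
  qed
  then show "xval a t w * (u - t * (1 - t))\<^sup>2 = (u - kpar a t) * u\<^sup>2"
    using assms(1) by simp
qed

lemma deriv_zmap:
  fixes \<zeta> :: complex and a t :: real
  defines "c \<equiv> of_real (t * (1 - t))" and "k \<equiv> of_real (kpar a t)"
  assumes "\<zeta> \<noteq> 0" "1 - c * \<zeta> \<noteq> 0"
  shows "deriv (zmap a t) \<zeta> = - (1 - 3 * c * \<zeta> + 2 * c * k * \<zeta>\<^sup>2) / (\<zeta>\<^sup>2 * (1 - c * \<zeta>) ^ 3)"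
proof -
  have N: "((\<lambda>\<zeta>. 1 - k * \<zeta>) has_field_derivative - k) (at \<zeta>)"
    by (auto intro!: derivative_eq_intros)
  have D: "((\<lambda>\<zeta>. \<zeta> * (1 - c * \<zeta>)\<^sup>2) has_field_derivative
      (1 - c * \<zeta>)\<^sup>2 - 2 * c * \<zeta> * (1 - c * \<zeta>)) (at \<zeta>)"
    by (auto intro!: derivative_eq_intros simp: power2_eq_square algebra_simps)
  have "(zmap a t has_field_derivative
      ((- k) * (\<zeta> * (1 - c * \<zeta>)\<^sup>2) - (1 - k * \<zeta>) * ((1 - c * \<zeta>)\<^sup>2 - 2 * c * \<zeta> * (1 - c * \<zeta>)))
        / (\<zeta> * (1 - c * \<zeta>)\<^sup>2)\<^sup>2) (at \<zeta>)"
    using DERIV_divide[OF N D] assms(3,4)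
    unfolding zmap_def[abs_def] c_def[symmetric] k_def[symmetric] by (simp add: power2_eq_square)
  then have "deriv (zmap a t) \<zeta> =
      ((- k) * (\<zeta> * (1 - c * \<zeta>)\<^sup>2) - (1 - k * \<zeta>) * ((1 - c * \<zeta>)\<^sup>2 - 2 * c * \<zeta> * (1 - c * \<zeta>)))
        / (\<zeta> * (1 - c * \<zeta>)\<^sup>2)\<^sup>2"
    by (rule DERIV_imp_deriv)
  also have "\<dots> = (- (1 - 3 * c * \<zeta> + 2 * c * k * \<zeta>\<^sup>2) * (1 - c * \<zeta>))
        / ((\<zeta>\<^sup>2 * (1 - c * \<zeta>) ^ 3) * (1 - c * \<zeta>))"
    by (rule arg_cong2[where f = "(/)"]; algebra)
  also have "\<dots> = - (1 - 3 * c * \<zeta> + 2 * c * k * \<zeta>\<^sup>2) / (\<zeta>\<^sup>2 * (1 - c * \<zeta>) ^ 3)"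
    using assms(4) by (rule nonzero_mult_divide_mult_cancel_right)
  finally show ?thesis .
qed

lemma branch_points_eq_inverse:
  assumes "a > 0" "0 < t" "t < 1"
  shows "z \<in> branch_points a t \<longleftrightarrow> z \<noteq> 0 \<and>
     (\<exists>u. u\<^sup>2 - 3 * of_real (t * (1 - t)) * u + 2 * of_real (t * (1 - t)) * of_real (kpar a t) = 0
        \<and> z * (u - of_real (t * (1 - t)))\<^sup>2 = (u - of_real (kpar a t)) * u\<^sup>2)"
proof -
  define c where "c = complex_of_real (t * (1 - t))"
  define k where "k = complex_of_real (kpar a t)"
  have "t * (1 - t) - kpar a t = a * (1 - t)\<^sup>2"
    unfolding kpar_def by algebra
  then have "t * (1 - t) \<noteq> kpar a t" using assms by auto
  then have ck: "c \<noteq> k" unfolding c_def k_def using of_real_eq_iff by blast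
  have c0: "c \<noteq> 0" using assms by (simp add: c_def)
  have uc: "u \<noteq> c" if "u\<^sup>2 - 3 * c * u + 2 * c * k = 0" for u
  proof
    assume "u = c"
    then have "2 * c * (k - c) = 0"
      using that by (simp add: power2_eq_square algebra_simps)
    then show False using ck c0 by simp
  qed
  show ?thesis
    unfolding c_def[symmetric] k_def[symmetric]
  proof
    assume "z \<in> branch_points a t"
    then obtain \<zeta> where \<zeta>: "\<zeta> \<noteq> 0" "1 - c * \<zeta> \<noteq> 0" "deriv (zmap a t) \<zeta> = 0"
      and z: "z = zmap a t \<zeta>" "z \<noteq> 0"
      unfolding branch_points_def c_def by auto
    have "- (1 - 3 * c * \<zeta> + 2 * c * k * \<zeta>\<^sup>2) / (\<zeta>\<^sup>2 * (1 - c * \<zeta>) ^ 3) = 0"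
      using \<zeta> deriv_zmap[of \<zeta> t a, folded c_def k_def] by metis
    moreover have "\<zeta>\<^sup>2 * (1 - c * \<zeta>) ^ 3 \<noteq> 0" using \<zeta> by simp
    ultimately have crit: "1 - 3 * c * \<zeta> + 2 * c * k * \<zeta>\<^sup>2 = 0"
      by (metis divide_eq_0_iff neg_equal_0_iff_equal)
    have "z * (\<zeta> * (1 - c * \<zeta>)\<^sup>2) = 1 - k * \<zeta>"
      using \<zeta> z(1) by (simp add: zmap_def c_def k_def)
    moreover have "1 / \<zeta> * \<zeta> = 1" using \<zeta>(1) by simp
    ultimately have "z * (1 / \<zeta> - c)\<^sup>2 = (1 / \<zeta> - k) * (1 / \<zeta>)\<^sup>2"
      by algebra
    moreover have "(1 / \<zeta>)\<^sup>2 - 3 * c * (1 / \<zeta>) + 2 * c * k = 0"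
      using \<zeta>(1) crit by (simp add: field_simps power2_eq_square)
    ultimately show "z \<noteq> 0 \<and> (\<exists>u. u\<^sup>2 - 3 * c * u + 2 * c * k = 0 \<and> z * (u - c)\<^sup>2 = (u - k) * u\<^sup>2)"
      using z(2) by blast
  next
    assume "z \<noteq> 0 \<and> (\<exists>u. u\<^sup>2 - 3 * c * u + 2 * c * k = 0 \<and> z * (u - c)\<^sup>2 = (u - k) * u\<^sup>2)"
    then obtain u where z: "z \<noteq> 0" and u: "u\<^sup>2 - 3 * c * u + 2 * c * k = 0"
      and e: "z * (u - c)\<^sup>2 = (u - k) * u\<^sup>2" by blast
    have "u \<noteq> 0" using uc[OF u] z e by auto
    define \<zeta> where "\<zeta> = 1 / u"
    have \<zeta>u: "\<zeta> * u = 1" using \<open>u \<noteq> 0\<close> by (simp add: \<zeta>_def)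
    have \<zeta>0: "\<zeta> \<noteq> 0" using \<open>u \<noteq> 0\<close> by (simp add: \<zeta>_def)
    have \<zeta>1: "1 - c * \<zeta> \<noteq> 0" using \<open>u \<noteq> 0\<close> uc[OF u] by (simp add: \<zeta>_def)
    have "1 - 3 * c * \<zeta> + 2 * c * k * \<zeta>\<^sup>2 = 0"
      using u \<zeta>u by algebra
    then have "deriv (zmap a t) \<zeta> = 0"
      using \<zeta>0 \<zeta>1 deriv_zmap[of \<zeta> t a] by (simp add: c_def k_def)
    moreover have "z * (\<zeta> * (1 - c * \<zeta>)\<^sup>2) = 1 - k * \<zeta>"
      using e \<zeta>u by algebra
    then have "z = zmap a t \<zeta>"
      using \<zeta>0 \<zeta>1 by (simp add: zmap_def c_def k_def field_simps)
    ultimately show "z \<in> branch_points a t"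
      using \<zeta>0 \<zeta>1 z unfolding branch_points_def c_def by blast
  qed
qed

lemma branch_points_iff_xval:
  assumes "a > 0" "0 < t" "t < 1" and w: "w\<^sup>2 = t * (t + 8 * a * (1 - t))"
  shows "z \<in> branch_points a t \<longleftrightarrow>
     z \<noteq> 0 \<and> (z = of_real (xval a t w) \<or> z = of_real (xval a t (- w)))"
proof -
  define c where "c = complex_of_real (t * (1 - t))"
  define k where "k = complex_of_real (kpar a t)"
  define u where "u v = (1 - t) * (3 * t + v) / 2" for v
  have w': "(- w)\<^sup>2 = t * (t + 8 * a * (1 - t))" using w by simp
  have eqs: "of_real (xval a t v) * (of_real (u v) - c)\<^sup>2 = (of_real (u v) - k) * (of_real (u v))\<^sup>2"
      "(of_real (u v))\<^sup>2 - 3 * c * of_real (u v) + 2 * c * k = 0"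
      "of_real (u v) \<noteq> c" if "v\<^sup>2 = t * (t + 8 * a * (1 - t))" for v
  proof -
    note * = xval_identity[OF assms(1,2) that u_def[of v]]
    show "of_real (xval a t v) * (of_real (u v) - c)\<^sup>2 = (of_real (u v) - k) * (of_real (u v))\<^sup>2"
      using *(1)[THEN arg_cong[where f = complex_of_real]] by (simp add: c_def k_def)
    show "(of_real (u v))\<^sup>2 - 3 * c * of_real (u v) + 2 * c * k = 0"
      using *(2)[THEN arg_cong[where f = complex_of_real]] by (simp add: c_def k_def)
    have "u v \<noteq> t * (1 - t)"
    proof
      assume "u v = t * (1 - t)"
      then have "(1 - t) * (3 * t + v) = 2 * (t * (1 - t))" unfolding u_def by simp
      then have "(1 - t) * (t + v) = 0" by algebra
      then have "v = - t" using assms(3) by auto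
      then have "t * (8 * a * (1 - t)) = 0" using that by algebra
      then show False using assms by auto
    qed
    then show "of_real (u v) \<noteq> c" unfolding c_def using of_real_eq_iff by blast
  qed
  have roots: "x = of_real (u w) \<or> x = of_real (u (- w))" if "x\<^sup>2 - 3 * c * x + 2 * c * k = 0" for x
  proof -
    have "u w + u (- w) = 3 * (t * (1 - t))" by (simp add: u_def field_simps)
    then have "complex_of_real (u w) + of_real (u (- w)) = 3 * c"
      unfolding c_def by (metis of_real_add of_real_mult of_real_numeral)
    then have "(x - of_real (u w)) * (x - of_real (u (- w))) = 0"
      using that eqs(2)[OF w] by algebra
    then show ?thesis by auto
  qed
  show ?thesis
    unfolding branch_points_eq_inverse[OF assms(1-3)] c_def[symmetric] k_def[symmetric]
  proof (intro conj_cong refl iffI)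
    assume "\<exists>x. x\<^sup>2 - 3 * c * x + 2 * c * k = 0 \<and> z * (x - c)\<^sup>2 = (x - k) * x\<^sup>2"
    then obtain x where "x\<^sup>2 - 3 * c * x + 2 * c * k = 0" and e: "z * (x - c)\<^sup>2 = (x - k) * x\<^sup>2"
      by blast
    then consider "x = of_real (u w)" | "x = of_real (u (- w))" using roots by blast
    then show "z = of_real (xval a t w) \<or> z = of_real (xval a t (- w))"
    proof cases
      case 1
      have "(z - of_real (xval a t w)) * (of_real (u w) - c)\<^sup>2 = 0"
        using e eqs(1)[OF w] unfolding 1 left_diff_distrib by (simp only: diff_self)
      then show ?thesis using eqs(3)[OF w] by simp
    next
      case 2
      have "(z - of_real (xval a t (- w))) * (of_real (u (- w)) - c)\<^sup>2 = 0"
        using e eqs(1)[OF w'] unfolding 2 left_diff_distrib by (simp only: diff_self)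
      then show ?thesis using eqs(3)[OF w'] by simp
    qed
  next
    assume "z = of_real (xval a t w) \<or> z = of_real (xval a t (- w))"
    then show "\<exists>x. x\<^sup>2 - 3 * c * x + 2 * c * k = 0 \<and> z * (x - c)\<^sup>2 = (x - k) * x\<^sup>2"
      using eqs(1,2)[OF w] eqs(1,2)[OF w'] by blast
  qed
qed

lemma branch_points_iff_quad:
  assumes "a > 0" "0 < t" "t < 1"
  shows "z \<in> branch_points a t \<longleftrightarrow> z \<noteq> 0 \<and> quad a t z = 0"
proof -
  have "(sqrt (t * (t + 8 * a * (1 - t))))\<^sup>2 = t * (t + 8 * a * (1 - t))"
    using assms by simp
  note branch_points_iff_xval[OF assms this] quad_factor[OF assms(1) this]
  then show ?thesis using assms(1) by auto
qed

lemma branch_xs_eq: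
  assumes "a > 0" "0 < t" "t < 1"
  defines "w \<equiv> sqrt (t * (t + 8 * a * (1 - t)))"
  shows "branch_xs a t = {xval a t (- w), xval a t w}"
    and "xval a t (- w) < xval a t w"
proof -
  have w2: "w\<^sup>2 = t * (t + 8 * a * (1 - t))"
    using assms by simp
  have quad0: "quad a t 0 = 0 \<longleftrightarrow> t = tstar a"
  proof -
    have "quad a t 0 = 0 \<longleftrightarrow> complex_of_real (4 * (1 - t) * (t - a * (1 - t)) ^ 3) = 0"
      by (simp only: quad_def power2_eq_square mult_zero_left mult_zero_right add_0_left
          diff_0 neg_equal_0_iff_equal)
    also have "\<dots> \<longleftrightarrow> 4 * (1 - t) * (t - a * (1 - t)) ^ 3 = 0"
      by (rule of_real_eq_0_iff)
    also have "\<dots> \<longleftrightarrow> t - a * (1 - t) = 0"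
      using assms(3) by simp
    also have "\<dots> \<longleftrightarrow> t = tstar a"
      using assms(1) by (simp add: tstar_def field_simps)
    finally show ?thesis .
  qed
  have "x \<in> branch_xs a t \<longleftrightarrow> quad a t (of_real x) = 0" for x
    using quad0 branch_points_iff_quad[OF assms(1-3), of "of_real x"]
    by (cases "x = 0") (auto simp: branch_xs_def)
  moreover have "quad a t (of_real x) = 0 \<longleftrightarrow> x = xval a t (- w) \<or> x = xval a t w" for x
    using quad_factor[OF assms(1) w2, of "of_real x"] assms(1) by auto
  ultimately show "branch_xs a t = {xval a t (- w), xval a t w}" by blast
  have "w > 0" using assms by (simp add: add_pos_nonneg)
  moreover have "t + 8 * a * (1 - t) > 0" using assms by (simp add: add_pos_nonneg)
  ultimately have "(t + 8 * a * (1 - t)) * (- w) < (t + 8 * a * (1 - t)) * w"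
    by (intro mult_strict_left_mono) auto
  then show "xval a t (- w) < xval a t w"
    unfolding xval_def by (rule divide_strict_right_mono[OF add_strict_left_mono]) (use assms(1) in simp)
qed

lemma p_q_quadratic:
  assumes "a > 0" "0 < t" "t < 1"
  shows "p_branch a t < q_branch a t"
    and "quad a t z = 0 \<longleftrightarrow> z = of_real (p_branch a t) \<or> z = of_real (q_branch a t)"
proof -
  define w where "w = sqrt (t * (t + 8 * a * (1 - t)))"
  note b = branch_xs_eq[OF assms, folded w_def]
  have pq: "p_branch a t = xval a t (- w)" "q_branch a t = xval a t w"
    using assms b by (auto simp: p_branch_def q_branch_def extend01_def)
  show "p_branch a t < q_branch a t" using b pq by simp
  have "w\<^sup>2 = t * (t + 8 * a * (1 - t))" using assms by (simp add: w_def)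
  then show "quad a t z = 0 \<longleftrightarrow> z = of_real (p_branch a t) \<or> z = of_real (q_branch a t)"
    using quad_factor[OF assms(1), of w t z] assms(1) pq by auto
qed

end

theory Submission
  imports Defs
begin

text \<open>
  On \<open>[0, 1]\<close> both boundary curves are given by the quadratic formula, with square root
  \<open>w = sqrt (t s)\<close>, \<open>s = t + 8 a (1 - t)\<close>.  Everything about second derivatives comes from
  \<open>(s w)'' = 2 H\<close>, where \<open>H\<close> is \<open>sqcurv a\<close>, and the cancellation \<open>H' = 96 a\<^sup>3 / (t w\<^sup>3) > 0\<close>: so \<open>q''\<close> is
  increasing, and for \<open>a \<le> 1\<close> concavity follows from \<open>q'' 1 = 8 (a - 1) \<le> 0\<close>.  For \<open>a > 1\<close> the curve lies
  above its tangent \<open>4 (1 - t)\<close> near \<open>t = 1\<close>, since the quadratic polynomial is negative there.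
  The signs of \<open>p\<close> are read off the product \<open>p q = - (1 - t) (t - a (1 - t))\<^sup>3 / a\<close>, and the first two
  derivatives of \<open>p\<close> vanish at \<open>t\<^sup>*\<close>, so cutting \<open>p\<close> off there keeps it twice continuously differentiable.
\<close>


section \<open>Closed form of the two branches and their first two derivatives\<close>

definition disc :: "real \<Rightarrow> real \<Rightarrow> real" where
  "disc a t = t * (t + 8 * a * (1 - t))"

text \<open>The sign \<sigma> = 1 selects the upper root and \<sigma> = -1 the lower one, so a
  single computation of derivatives serves both boundary curves.\<close>

definition xbranch :: "real \<Rightarrow> real \<Rightarrow> real \<Rightarrow> real" where
  "xbranch a \<sigma> t = xval a t (\<sigma> * sqrt (disc a t))"

definition xbranch' :: "real \<Rightarrow> real \<Rightarrow> real \<Rightarrow> real" where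
  "xbranch' a \<sigma> t = (20 * a * (1 - 2 * t) - 2 * t - 16 * a\<^sup>2 * (1 - t)
     + \<sigma> * ((t + 8 * a * (1 - t)) * (2 * (1 - 8 * a) * t + 4 * a) / sqrt (disc a t))) / (8 * a)"

definition sqcurv :: "real \<Rightarrow> real \<Rightarrow> real" where
  "sqcurv a t = ((1 - 8 * a)\<^sup>2 * t\<^sup>2 + 4 * a * (1 - 8 * a) * t - 8 * a\<^sup>2) / (t * sqrt (disc a t))"

definition xbranch'' :: "real \<Rightarrow> real \<Rightarrow> real \<Rightarrow> real" where
  "xbranch'' a \<sigma> t = (8 * a\<^sup>2 - 20 * a - 1 + \<sigma> * sqcurv a t) / (4 * a)"

lemma disc_pos: "a > 0 \<Longrightarrow> 0 < t \<Longrightarrow> t \<le> 1 \<Longrightarrow> disc a t > 0"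
  by (simp add: disc_def add_pos_nonneg)

lemma sqrt_disc_deriv:
  assumes "disc a t > 0"
  shows "((\<lambda>t. sqrt (disc a t)) has_real_derivative ((1 - 8 * a) * t + 4 * a) / sqrt (disc a t)) (at t)"
proof -
  have "(disc a has_real_derivative 2 * ((1 - 8 * a) * t + 4 * a)) (at t)"
    unfolding disc_def[abs_def] by (auto intro!: derivative_eq_intros simp: algebra_simps)
  from DERIV_chain2[OF DERIV_real_sqrt[OF assms] this]
  have "((\<lambda>t. sqrt (disc a t)) has_real_derivative
      inverse (sqrt (disc a t)) / 2 * (2 * ((1 - 8 * a) * t + 4 * a))) (at t)" .
  then show ?thesis
    by (simp only: times_divide_eq_left mult_2 divide_inverse) (simp add: algebra_simps)
qed

lemma xbranch_deriv:
  assumes "a > 0" "disc a t > 0"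
  shows "(xbranch a \<sigma> has_real_derivative xbranch' a \<sigma> t) (at t)"
proof -
  define w where "w = sqrt (disc a t)"
  have w: "w > 0" "w * w = t * (t + 8 * a * (1 - t))"
    using assms by (auto simp: w_def disc_def)
  have D: "((\<lambda>t. (t + 8 * a * (1 - t)) * sqrt (disc a t)) has_real_derivative
      (1 - 8 * a) * w + (t + 8 * a * (1 - t)) * (((1 - 8 * a) * t + 4 * a) / w)) (at t)"
    unfolding w_def by (rule derivative_eq_intros sqrt_disc_deriv assms refl | simp add: algebra_simps)+
  have "(1 - 8 * a) * w + (t + 8 * a * (1 - t)) * (((1 - 8 * a) * t + 4 * a) / w)
      = ((1 - 8 * a) * (w * w) + (t + 8 * a * (1 - t)) * ((1 - 8 * a) * t + 4 * a)) / w"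
    using w(1) by (simp add: add_divide_distrib distrib_left)
  also have "\<dots> = (t + 8 * a * (1 - t)) * (2 * (1 - 8 * a) * t + 4 * a) / w"
    unfolding w(2) by (rule arg_cong2[where f = "(/)"]) (algebra, simp)
  finally have D': "((\<lambda>t. (t + 8 * a * (1 - t)) * sqrt (disc a t)) has_real_derivative
      (t + 8 * a * (1 - t)) * (2 * (1 - 8 * a) * t + 4 * a) / w) (at t)"
    using D by simp
  have B: "((\<lambda>t. t\<^sup>2 - 20 * a * t * (1 - t) - 8 * a\<^sup>2 * (1 - t)\<^sup>2) has_real_derivative
      - (20 * a * (1 - 2 * t) - 2 * t - 16 * a\<^sup>2 * (1 - t))) (at t)"
    by (auto intro!: derivative_eq_intros) algebra
  have eq: "xbranch a \<sigma> = (\<lambda>t. (- (t\<^sup>2 - 20 * a * t * (1 - t) - 8 * a\<^sup>2 * (1 - t)\<^sup>2)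
      + \<sigma> * ((t + 8 * a * (1 - t)) * sqrt (disc a t))) / (8 * a))"
    by (auto simp: xbranch_def xval_def mult.left_commute)
  show ?thesis
    unfolding eq xbranch'_def w_def[symmetric]
    using DERIV_cdivide[OF DERIV_add[OF DERIV_minus[OF B] DERIV_cmult[OF D', of \<sigma>]], of "8 * a"]
    by simp
qed

lemma xbranch'_deriv:
  assumes "a > 0" "0 < t" "disc a t > 0"
  shows "(xbranch' a \<sigma> has_real_derivative xbranch'' a \<sigma> t) (at t)"
proof -
  define w where "w = sqrt (disc a t)"
  define c where "c = 1 - 8 * a"
  define s where "s = t + 8 * a * (1 - t)"
  have w: "w > 0" "w\<^sup>2 = t * s"
    using assms by (auto simp: w_def disc_def s_def)
  then have s0: "s > 0" using assms(2) by (metis zero_less_mult_pos zero_less_power)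
  have "((\<lambda>t. (t + 8 * a * (1 - t)) * (2 * (1 - 8 * a) * t + 4 * a)) has_real_derivative
      c * (2 * c * t + 4 * a) + s * (2 * c)) (at t)"
    unfolding c_def s_def by (auto intro!: derivative_eq_intros)
  from DERIV_divide[OF this sqrt_disc_deriv[OF assms(3)]] w(1)
  have D: "((\<lambda>t. (t + 8 * a * (1 - t)) * (2 * (1 - 8 * a) * t + 4 * a) / sqrt (disc a t)) has_real_derivative
      ((c * (2 * c * t + 4 * a) + s * (2 * c)) * w - s * (2 * c * t + 4 * a) * ((c * t + 4 * a) / w))
        / (w * w)) (at t)"
    by (simp add: w_def[symmetric] c_def s_def)
  have "((c * (2 * c * t + 4 * a) + s * (2 * c)) * w - s * (2 * c * t + 4 * a) * ((c * t + 4 * a) / w)) / (w * w)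
    = ((c * (2 * c * t + 4 * a) + s * (2 * c)) * w\<^sup>2 - s * (2 * c * t + 4 * a) * (c * t + 4 * a)) / (w\<^sup>2 * w)"
    using w(1) by (simp add: field_simps power2_eq_square)
  \<comment> \<open>Once \<open>w\<^sup>2\<close> is replaced by t s, numerator and denominator
    share the factor s; cancelling it leaves twice the curvature term.\<close>
  also have "\<dots> = (s * (2 * (c\<^sup>2 * t\<^sup>2 + 4 * a * c * t - 8 * a\<^sup>2))) / (s * (t * w))"
    unfolding w(2) by (rule arg_cong2[where f = "(/)"]) (unfold c_def s_def, algebra, algebra)
  also have "\<dots> = 2 * sqcurv a t"
    using s0 by (simp add: sqcurv_def w_def c_def)
  finally have D': "((\<lambda>t. (t + 8 * a * (1 - t)) * (2 * (1 - 8 * a) * t + 4 * a) / sqrt (disc a t))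
      has_real_derivative 2 * sqcurv a t) (at t)"
    using D by simp
  have B: "((\<lambda>t. 20 * a * (1 - 2 * t) - 2 * t - 16 * a\<^sup>2 * (1 - t)) has_real_derivative
      2 * (8 * a\<^sup>2 - 20 * a - 1)) (at t)"
    by (auto intro!: derivative_eq_intros)
  have "(2 * (8 * a\<^sup>2 - 20 * a - 1) + \<sigma> * (2 * sqcurv a t)) / (8 * a) = xbranch'' a \<sigma> t"
    using assms(1) by (simp add: xbranch''_def field_simps)
  with DERIV_cdivide[OF DERIV_add[OF B DERIV_cmult[OF D', of \<sigma>]], of "8 * a"]
  show ?thesis
    unfolding xbranch'_def[abs_def] by simp
qed

lemma sqcurv_deriv:
  assumes "a > 0" "0 < t" "disc a t > 0"
  shows "(sqcurv a has_real_derivative 96 * a ^ 3 / (t * sqrt (disc a t) ^ 3)) (at t)"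
proof -
  define w where "w = sqrt (disc a t)"
  define c where "c = 1 - 8 * a"
  have w: "w > 0" "w\<^sup>2 = t * (c * t + 8 * a)"
    using assms by (auto simp: w_def disc_def c_def algebra_simps)
  have N: "((\<lambda>t. (1 - 8 * a)\<^sup>2 * t\<^sup>2 + 4 * a * (1 - 8 * a) * t - 8 * a\<^sup>2) has_real_derivative
      2 * c\<^sup>2 * t + 4 * a * c) (at t)"
    unfolding c_def by (auto intro!: derivative_eq_intros)
  have M: "((\<lambda>t. t * sqrt (disc a t)) has_real_derivative w + t * ((c * t + 4 * a) / w)) (at t)"
    unfolding c_def w_def by (rule derivative_eq_intros sqrt_disc_deriv assms refl | simp add: algebra_simps)+
  have "(sqcurv a has_real_derivative
      ((2 * c\<^sup>2 * t + 4 * a * c) * (t * w)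
        - (c\<^sup>2 * t\<^sup>2 + 4 * a * c * t - 8 * a\<^sup>2) * (w + t * ((c * t + 4 * a) / w))) / ((t * w) * (t * w))) (at t)"
    using DERIV_divide[OF N M] assms(2) w(1)
    unfolding sqcurv_def[abs_def] by (simp add: w_def[symmetric] c_def)
  moreover have "((2 * c\<^sup>2 * t + 4 * a * c) * (t * w)
        - (c\<^sup>2 * t\<^sup>2 + 4 * a * c * t - 8 * a\<^sup>2) * (w + t * ((c * t + 4 * a) / w))) / ((t * w) * (t * w))
      = ((2 * c\<^sup>2 * t + 4 * a * c) * t * w\<^sup>2
        - (c\<^sup>2 * t\<^sup>2 + 4 * a * c * t - 8 * a\<^sup>2) * (w\<^sup>2 + t * (c * t + 4 * a))) / (t\<^sup>2 * w ^ 3)"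
    using w(1) assms(2) by (simp add: field_simps power2_eq_square power3_eq_cube)
  \<comment> \<open>After inserting \<open>w\<^sup>2\<close> and factoring out t, all remaining
    positive powers of t cancel, so the derivative has constant sign.\<close>
  moreover have "(2 * c\<^sup>2 * t + 4 * a * c) * t * w\<^sup>2
        - (c\<^sup>2 * t\<^sup>2 + 4 * a * c * t - 8 * a\<^sup>2) * (w\<^sup>2 + t * (c * t + 4 * a)) = t * (96 * a ^ 3)"
    unfolding w(2) by algebra
  moreover have "t * (96 * a ^ 3) / (t\<^sup>2 * w ^ 3) = 96 * a ^ 3 / (t * w ^ 3)"
    using assms(2) by (simp add: power2_eq_square)
  ultimately show ?thesis unfolding w_def by simp
qed

text \<open>The derivative found above is positive, so the value at 1 is the largest. It is the
  value that yields q''(1) = 8 (a - 1).\<close>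

lemma sqcurv_le:
  assumes "a > 0" "0 < t" "t \<le> 1"
  shows "sqcurv a t \<le> 24 * a\<^sup>2 - 12 * a + 1"
proof -
  have "sqcurv a t \<le> sqcurv a 1"
  proof (rule DERIV_nonneg_imp_nondecreasing[OF assms(3)], intro exI conjI)
    fix x assume x: "t \<le> x" "x \<le> 1"
    then have d: "disc a x > 0" using assms disc_pos by simp
    show "(sqcurv a has_real_derivative 96 * a ^ 3 / (x * sqrt (disc a x) ^ 3)) (at x)"
      using sqcurv_deriv d x assms by simp
    show "0 \<le> 96 * a ^ 3 / (x * sqrt (disc a x) ^ 3)" using d x assms by simp
  qed
  also have "sqcurv a 1 = 24 * a\<^sup>2 - 12 * a + 1"
    by (simp add: sqcurv_def disc_def power2_eq_square algebra_simps)
  finally show ?thesis .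
qed

section \<open>Sum, factorization and order of the two roots\<close>

lemma xbranch_sum: "a > 0 \<Longrightarrow> 4 * a * (xbranch a 1 t + xbranch a (- 1) t)
    = - (t\<^sup>2 - 20 * a * t * (1 - t) - 8 * a\<^sup>2 * (1 - t)\<^sup>2)"
  by (simp add: xbranch_def xval_def field_simps)

text \<open>Real form of \<open>quad_factor\<close>. Evaluated at x = 0, x = 4 (1 - t) and x = a + 1
  it gives the signs of p, the failure of concavity for a > 1 and the maximum of q, all without
  handling the square root.\<close>

lemma xbranch_quad:
  assumes "a > 0" "disc a t \<ge> 0"
  shows "4 * a * (x - xbranch a 1 t) * (x - xbranch a (- 1) t)
    = 4 * a * x\<^sup>2 + x * (t\<^sup>2 - 20 * a * t * (1 - t) - 8 * a\<^sup>2 * (1 - t)\<^sup>2)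
      - 4 * (1 - t) * (t - a * (1 - t)) ^ 3" (is "?l = ?r")
proof -
  have "(sqrt (disc a t))\<^sup>2 = t * (t + 8 * a * (1 - t))"
    using assms by (simp add: disc_def)
  from quad_factor[OF assms(1) this, of "of_real x"]
  have "complex_of_real ?r = of_real ?l"
    by (simp add: quad_def xbranch_def)
  then show ?thesis using of_real_eq_iff by metis
qed

lemma xbranch_le:
  assumes "a > 0" "0 \<le> t" "t \<le> 1"
  shows "xbranch a (- 1) t \<le> xbranch a 1 t"
proof -
  have "(t + 8 * a * (1 - t)) * sqrt (disc a t) \<ge> 0"
    using assms by (simp add: disc_def)
  then have "(t + 8 * a * (1 - t)) * (- 1 * sqrt (disc a t)) \<le> (t + 8 * a * (1 - t)) * (1 * sqrt (disc a t))"
    by simp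
  then show ?thesis
    unfolding xbranch_def xval_def using assms(1)
    by (intro divide_right_mono add_left_mono) simp_all
qed

section \<open>Identification of the extended branches with the closed form\<close>

lemma continuous_on_xbranch: "a > 0 \<Longrightarrow> continuous_on A (xbranch a \<sigma>)"
  unfolding xbranch_def[abs_def] xval_def disc_def by (intro continuous_intros) auto

text \<open>Each endpoint is a limit point of the open interval, on which f and the continuous g
  agree; hence the limit defining the extension is the value of g.\<close>

lemma extend01_eq:
  assumes "continuous_on UNIV g" "\<And>t. 0 < t \<Longrightarrow> t < 1 \<Longrightarrow> f t = g t" "t \<in> {0..1}"
  shows "extend01 f t = g t"
proof (cases "t \<in> {0<..<1}")
  case True
  then show ?thesis using assms(2) by (simp add: extend01_def)
next
  case False
  have "t islimpt {0<..<1::real}"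
    using assms(3) False by (auto simp: islimpt_greaterThanLessThan1 islimpt_greaterThanLessThan2
        less_le)
  then have nb: "at t within {0<..<1} \<noteq> bot" by (simp add: trivial_limit_within)
  have "(g \<longlongrightarrow> g t) (at t within {0<..<1})"
    using assms(1) by (meson UNIV_I continuous_on_def subset_UNIV tendsto_within_subset)
  then have "(f \<longlongrightarrow> g t) (at t within {0<..<1})"
    by (rule Lim_transform_eventually) (use assms(2) in \<open>auto simp: eventually_at_filter\<close>)
  then have "Lim (at t within {0<..<1}) f = g t" using nb by (simp add: tendsto_Lim)
  then show ?thesis using False by (auto simp: extend01_def)
qed

lemma branches_eq_xbranch:
  assumes "a > 0" "t \<in> {0..1}"
  shows "q_branch a t = xbranch a 1 t" "p_branch a t = xbranch a (- 1) t"
proof -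
  have "Max (branch_xs a t) = xbranch a 1 t" "Min (branch_xs a t) = xbranch a (- 1) t"
    if "0 < t" "t < 1" for t
    using branch_xs_eq[OF assms(1) that] by (simp_all add: xbranch_def disc_def)
  then show "q_branch a t = xbranch a 1 t" "p_branch a t = xbranch a (- 1) t"
    unfolding q_branch_def p_branch_def
    using assms by (auto intro!: extend01_eq continuous_on_xbranch)
qed

section \<open>Concavity: passing to an endpoint, and tangent lines\<close>

text \<open>The second derivative test will be applied only for t > 0, because \<open>disc a\<close>
  vanishes at 0; continuity then has to supply the left endpoint.\<close>

lemma concave_on_Icc_if_Ioc:
  fixes f :: "real \<Rightarrow> real"
  assumes "concave_on {a<..b} f" "continuous_on {a..b} f"
  shows "concave_on {a..b} f"
proof (rule concave_on_linorderI)
  fix l x y :: real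
  assume l: "l > 0" "l < 1" and xy: "x \<in> {a..b}" "y \<in> {a..b}" "x < y"
  have ge: "(1 - l) * f z + l * f y \<le> f ((1 - l) * z + l * y)" if "a < z" "z \<le> b" for z
    using concave_onD[OF assms(1), of l z y] l xy that by simp
  show "(1 - l) * f x + l * f y \<le> f ((1 - l) *\<^sub>R x + l *\<^sub>R y)"
  proof (cases "x = a")
    case False
    then show ?thesis using ge xy by simp
  next
    case True
    \<comment> \<open>As x < y, only x can be the left endpoint. The inequality there is the limit
      of the inequalities \<open>ge\<close> for z decreasing to x.\<close>
    have nb: "at x within {x<..<y} \<noteq> bot"
      using xy(3) by (simp add: trivial_limit_within islimpt_greaterThanLessThan1)
    have in_ab: "(1 - l) * z + l * y \<in> {a..b}" if "z \<in> {a..b}" for z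
      using convexD[of "{a..b}" z y "1 - l" l] l xy that by simp
    have "continuous_on {a..b} (\<lambda>z. f ((1 - l) * z + l * y))"
      by (rule continuous_on_compose2[OF assms(2)]) (use in_ab in \<open>auto intro!: continuous_intros\<close>)
    then have "((\<lambda>z. f ((1 - l) * z + l * y)) \<longlongrightarrow> f ((1 - l) * x + l * y)) (at x within {a..b})"
      using xy(1) by (auto simp: continuous_on_def)
    then have 1: "((\<lambda>z. f ((1 - l) * z + l * y)) \<longlongrightarrow> f ((1 - l) * x + l * y)) (at x within {x<..<y})"
      by (rule tendsto_within_subset) (use xy in auto)
    have "(f \<longlongrightarrow> f x) (at x within {a..b})"
      using xy(1) assms(2) by (auto simp: continuous_on_def)
    then have "(f \<longlongrightarrow> f x) (at x within {x<..<y})"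
      by (rule tendsto_within_subset) (use xy in auto)
    then have 2: "((\<lambda>z. (1 - l) * f z + l * f y) \<longlongrightarrow> (1 - l) * f x + l * f y) (at x within {x<..<y})"
      by (intro tendsto_intros)
    have "eventually (\<lambda>z. (1 - l) * f z + l * f y \<le> f ((1 - l) * z + l * y)) (at x within {x<..<y})"
      using xy True by (auto simp: eventually_at_filter intro!: always_eventually ge)
    from tendsto_le[OF nb 1 2 this] show ?thesis by simp
  qed
qed simp

text \<open>By concavity the increment from c to x is at most the difference quotient in u at c + u
  (x - c), for every u in (0, 1]; these quotients tend to D (x - c) as u tends to 0.\<close>

lemma concave_on_le_tangent:
  fixes f :: "real \<Rightarrow> real"
  assumes "concave_on S f" "(f has_real_derivative D) (at c within S)" "c \<in> S" "x \<in> S"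
  shows "f x \<le> f c + D * (x - c)"
proof -
  \<comment> \<open>Parametrizing the segment by u treats both sides of c alike and copes with a
    one-sided derivative at a boundary point of S.\<close>
  let ?g = "\<lambda>u. c + u * (x - c)"
  have "?g u \<in> S" if "u \<in> {0..1}" for u
    using convexD_alt[OF concave_on_imp_convex[OF assms(1)] assms(3,4), of u] that
    by (simp add: algebra_simps)
  then have "(f has_real_derivative D) (at (?g 0) within ?g ` {0..1})"
    using assms(2) by (auto intro: DERIV_subset)
  moreover have "(?g has_real_derivative x - c) (at 0 within {0..1})"
    by (auto intro!: derivative_eq_intros)
  ultimately have "((\<lambda>u. f (?g u)) has_real_derivative D * (x - c)) (at 0 within {0..1})"
    using DERIV_image_chain[of f D ?g 0 "{0..1}" "x - c"] by (simp add: o_def)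
  then have lim: "((\<lambda>u. (f (?g u) - f c) / u) \<longlongrightarrow> D * (x - c)) (at 0 within {0..1})"
    by (simp add: has_field_derivative_iff)
  have "f x - f c \<le> (f (?g u) - f c) / u" if "0 < u" "u \<le> 1" for u
  proof -
    have "(1 - u) * f c + u * f x \<le> f (?g u)"
      using concave_onD[OF assms(1), of u c x] assms(3,4) that by (simp add: algebra_simps)
    then show ?thesis using that by (simp add: field_simps)
  qed
  then have "eventually (\<lambda>u. f x - f c \<le> (f (?g u) - f c) / u) (at 0 within {0..1})"
    by (auto simp: eventually_at_filter intro!: always_eventually)
  moreover have "at (0::real) within {0..1} \<noteq> bot"
    by (simp add: trivial_limit_within islimpt_Icc)
  ultimately have "f x - f c \<le> D * (x - c)"
    using tendsto_lowerbound[OF lim] by blast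
  then show ?thesis by simp
qed

section \<open>Cutting a function off at a zero of higher order\<close>

text \<open>Unlike the positive part, which depends on the sign of f, this cut-off commutes with
  differentiation as soon as f and its derivative vanish at c.\<close>

definition left_part :: "real \<Rightarrow> (real \<Rightarrow> real) \<Rightarrow> real \<Rightarrow> real" where
  "left_part c f t = (if t < c then f t else 0)"

lemma left_part_deriv:
  assumes "(f has_real_derivative D t) (at t)" "t = c \<Longrightarrow> f c = 0" "t = c \<Longrightarrow> D c = 0"
  shows "(left_part c f has_real_derivative left_part c D t) (at t)"
proof -
  consider "t < c" | "t > c" | "t = c" by linarith
  then show ?thesis
  proof cases
    case 1
    have "(left_part c f has_real_derivative D t) (at t)"
      by (rule has_field_derivative_transform_within_open[OF assms(1), of "{..<c}"])
        (use 1 in \<open>auto simp: left_part_def\<close>)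
    then show ?thesis using 1 by (simp add: left_part_def)
  next
    case 2
    have "(left_part c f has_real_derivative 0) (at t)"
      by (rule has_field_derivative_transform_within_open[of "\<lambda>_. 0" _ _ "{c<..}"])
        (use 2 in \<open>auto simp: left_part_def\<close>)
    then show ?thesis using 2 by (simp add: left_part_def)
  next
    case 3
    then have "((\<lambda>y. f y / (y - c)) \<longlongrightarrow> 0) (at c)"
      using assms by (simp add: has_field_derivative_iff)
    \<comment> \<open>The quotient of the cut-off function is either that of f or 0, so it is
      dominated in absolute value by a null function.\<close>
    then have "((\<lambda>y. left_part c f y / (y - c)) \<longlongrightarrow> 0) (at c)"
      by (rule Lim_null_comparison[rotated, OF tendsto_norm_zero])
        (auto simp: left_part_def intro!: always_eventually)
    then show ?thesis using 3 by (simp add: has_field_derivative_iff left_part_def)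
  qed
qed

lemma left_part_isCont:
  assumes "isCont f c" "f c = 0"
  shows "isCont (left_part c f) c"
proof -
  have "(f \<longlongrightarrow> 0) (at c)" using assms by (simp add: isCont_def)
  then have "(left_part c f \<longlongrightarrow> 0) (at c)"
    by (rule Lim_null_comparison[rotated, OF tendsto_norm_zero])
      (auto simp: left_part_def intro!: always_eventually)
  then show ?thesis by (simp add: isCont_def left_part_def)
qed

text \<open>\<open>left_part_deriv\<close> is applied to f and then to f'. The first application
  identifies \<open>deriv g\<close> on all of the open set S, which is what permits the second;
  continuity of the second derivative at c comes from f'' tending to f''(c) = 0.\<close>

lemma left_part_C2:
  assumes "open S" "c \<in> S"
    and g: "\<And>t. t \<in> S \<Longrightarrow> g t = left_part c f t"
    and f: "\<And>t. t \<in> S \<Longrightarrow> (f has_real_derivative f' t) (at t)"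
      "\<And>t. t \<in> S \<Longrightarrow> (f' has_real_derivative f'' t) (at t)"
    and "isCont f'' c" "f c = 0" "f' c = 0" "f'' c = 0"
  shows "eventually (\<lambda>t. g field_differentiable (at t) \<and> deriv g field_differentiable (at t)) (nhds c)"
    and "isCont (deriv g) c" "isCont (deriv (deriv g)) c"
proof -
  have 1: "(g has_real_derivative left_part c f' t) (at t)" if "t \<in> S" for t
    by (rule has_field_derivative_transform_within_open[OF _ assms(1) that g[symmetric]])
      (use that assms in \<open>auto intro: left_part_deriv\<close>)
  then have d: "deriv g t = left_part c f' t" if "t \<in> S" for t
    using that by (simp add: DERIV_imp_deriv)
  have 2: "(deriv g has_real_derivative left_part c f'' t) (at t)" if "t \<in> S" for t
    by (rule has_field_derivative_transform_within_open[OF _ assms(1) that d[symmetric]])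
      (use that assms in \<open>auto intro: left_part_deriv\<close>)
  show "eventually (\<lambda>t. g field_differentiable (at t) \<and> deriv g field_differentiable (at t)) (nhds c)"
    unfolding eventually_nhds field_differentiable_def using 1 2 assms(1,2) by blast
  show "isCont (deriv g) c" using 2[OF assms(2)] by (rule DERIV_isCont)
  have "eventually (\<lambda>t. deriv (deriv g) t = left_part c f'' t) (nhds c)"
    unfolding eventually_nhds using 2 assms(1,2) DERIV_imp_deriv by blast
  then show "isCont (deriv (deriv g)) c"
    using isCont_cong left_part_isCont assms(6,9) by blast
qed

section \<open>The lower curve: signs, and derivatives at \<open>tstar a\<close>\<close>

text \<open>Up to \<open>tstar a\<close> the upper root is positive, so the lower root has the sign
  of the product of the roots. Beyond it the product is at most 0, whereas a positive lower root
  would make both roots positive.\<close>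

lemma xbranch_signs:
  assumes "a > 0" "0 \<le> t" "t \<le> 1"
  shows "t < tstar a \<Longrightarrow> xbranch a (- 1) t > 0"
    and "t \<ge> tstar a \<Longrightarrow> xbranch a (- 1) t \<le> 0"
    and "t = tstar a \<Longrightarrow> xbranch a (- 1) t = 0"
proof -
  let ?p = "xbranch a (- 1) t" and ?q = "xbranch a 1 t"
  have "disc a t \<ge> 0" using assms by (simp add: disc_def)
  then have "4 * (a * ?q * ?p) = - (4 * (1 - t) * (t - a * (1 - t)) ^ 3)"
    using xbranch_quad[OF assms(1), of t 0] by simp
  also have "\<dots> = 4 * ((1 - t) * (a * (1 - t) - t) ^ 3)" by algebra
  finally have prod: "a * ?q * ?p = (1 - t) * (a * (1 - t) - t) ^ 3" by simp
  have le: "?p \<le> ?q" using xbranch_le assms by simp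
  have lt_iff: "t < tstar a \<longleftrightarrow> t < a * (1 - t)" "t = tstar a \<longleftrightarrow> t = a * (1 - t)"
    using assms(1) by (auto simp: tstar_def field_simps)
  \<comment> \<open>Here t \<le> a (1 - t), so t^2 is absorbed by the term 20 a t (1 - t): the sum
    of the roots is positive, hence so is the larger root.\<close>
  have q: "?q > 0" if "t \<le> tstar a"
  proof -
    have t: "t \<le> a * (1 - t)" using that lt_iff by linarith
    then have t1: "t < 1" using assms by (cases "t = 1") auto
    have "t * t \<le> t * (a * (1 - t))" using t assms(2) by (rule mult_left_mono)
    moreover have "0 \<le> a * t * (1 - t)" using assms by simp
    moreover have "0 < a\<^sup>2 * (1 - t)\<^sup>2" using assms t1 by simp
    ultimately have "0 < 4 * a * (?q + ?p)"
      unfolding xbranch_sum[OF assms(1)] power2_eq_square[of t] by (simp add: mult_ac) argo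
    then have "0 < ?q + ?p" using assms(1) by (simp add: zero_less_mult_iff)
    then show ?thesis using le by linarith
  qed
  show "?p > 0" if "t < tstar a"
  proof -
    have t: "t < a * (1 - t)" using that lt_iff by simp
    then have t1: "t < 1" using assms by (cases "t = 1") auto
    have "0 < a * ?q * ?p" unfolding prod using t t1 by simp
    moreover have "0 < a * ?q" using q that assms(1) by simp
    ultimately show ?thesis using zero_less_mult_pos by blast
  qed
  show "?p = 0" if "t = tstar a"
    using prod q that lt_iff(2) assms(1) by simp
  show "?p \<le> 0" if "t \<ge> tstar a"
  proof (rule ccontr)
    assume "\<not> ?p \<le> 0"
    then have "0 < a * ?q * ?p" using le assms(1) by simp
    moreover have "(a * (1 - t) - t) ^ 3 \<le> 0"
      using that lt_iff by (simp add: power_le_zero_eq)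
    then have "(1 - t) * (a * (1 - t) - t) ^ 3 \<le> 0"
      using assms(3) by (simp add: mult_nonneg_nonpos)
    ultimately show False using prod by simp
  qed
qed

text \<open>The product of the roots has a triple zero at \<open>tstar a\<close>, where q is
  positive, so p must vanish to third order. The explicit check is rational because
  \<open>disc a\<close> equals the square of 3 a / (a + 1) there.\<close>

lemma xbranch_derivs_tstar:
  assumes "a > 0"
  shows "xbranch' a (- 1) (tstar a) = 0" "xbranch'' a (- 1) (tstar a) = 0"
proof -
  define d where "d = 1 + a"
  have d: "d > 0" "a = d - 1" using assms by (auto simp: d_def)
  have t: "tstar a = a / d" "1 - a / d = 1 / d" using d by (simp_all add: tstar_def field_simps)
  have s: "tstar a + 8 * a * (1 - tstar a) = 3 * (3 * a / d)"
    unfolding t using d(1) by (simp add: field_simps)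
  have "disc a (tstar a) = (3 * a / d)\<^sup>2"
    unfolding disc_def s by (simp add: t power2_eq_square)
  then have w: "sqrt (disc a (tstar a)) = 3 * a / d"
    using assms d by simp
  have "(tstar a + 8 * a * (1 - tstar a)) * (2 * (1 - 8 * a) * tstar a + 4 * a) / (3 * a / d)
      = 3 * (2 * (1 - 8 * a) * a / d + 4 * a)"
    unfolding s using d(1) assms by (simp add: t)
  also have "\<dots> = 20 * a * (1 - 2 * tstar a) - 2 * tstar a - 16 * a\<^sup>2 * (1 - tstar a)"
    unfolding t using d(1) by (simp add: divide_simps) (simp add: d_def power2_eq_square algebra_simps)
  finally show "xbranch' a (- 1) (tstar a) = 0"
    unfolding xbranch'_def w by simp
  have "sqcurv a (tstar a) = ((1 - 8 * a)\<^sup>2 + 4 * (1 - 8 * a) * d - 8 * d\<^sup>2) / 3"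
    unfolding sqcurv_def w unfolding t using d(1) assms by (simp add: field_simps power2_eq_square)
  also have "\<dots> = 8 * a\<^sup>2 - 20 * a - 1"
    unfolding d_def by (simp add: power2_eq_square field_simps)
  finally show "xbranch'' a (- 1) (tstar a) = 0"
    by (simp add: xbranch''_def)
qed

section \<open>The upper curve: concavity and the tangent at 1\<close>

lemma xbranch_upper_concave:
  assumes "0 < a" "a \<le> 1"
  shows "concave_on {0..1} (xbranch a 1)"
proof (rule concave_on_Icc_if_Ioc[OF _ continuous_on_xbranch[OF assms(1)]], rule f''_le0_imp_concave)
  fix t :: real assume t: "t \<in> {0<..1}"
  then have d: "disc a t > 0" using disc_pos assms by simp
  show "(xbranch a 1 has_real_derivative xbranch' a 1 t) (at t)"
    using xbranch_deriv assms d by simp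
  show "(xbranch' a 1 has_real_derivative xbranch'' a 1 t) (at t)"
    using xbranch'_deriv assms d t by simp
  \<comment> \<open>By \<open>sqcurv_le\<close> the numerator of q'' is at most 32 (a^2 - a), so a
    \<le> 1 enters through this inequality.\<close>
  have "a\<^sup>2 \<le> a" using assms by (simp add: power2_eq_square mult_left_le)
  then have "8 * a\<^sup>2 - 20 * a - 1 + sqcurv a t \<le> 0"
    using sqcurv_le[of a t] assms(1) t by simp
  then show "xbranch'' a 1 t \<le> 0"
    unfolding xbranch''_def using assms(1) by (simp add: divide_le_0_iff)
qed simp

lemma xbranch_upper_deriv_1:
  assumes "0 < a"
  shows "(xbranch a 1 has_real_derivative - 4) (at 1)"
proof -
  have "disc a 1 = 1" by (simp add: disc_def)
  moreover from this have "xbranch' a 1 1 = - 4"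
    using assms by (simp add: xbranch'_def field_simps)
  ultimately show ?thesis using xbranch_deriv[OF assms, of 1 1] by simp
qed

lemma xbranch_upper_1: "a > 0 \<Longrightarrow> xbranch a 1 1 = 0"
  by (simp add: xbranch_def xval_def disc_def)

lemma xbranch_upper_gt_tangent:
  assumes "1 < a"
  obtains t where "0 \<le> t" "t \<le> 1" "xbranch a 1 t > 4 * (1 - t)"
proof -
  \<comment> \<open>With r = 1 - t, this is the quadratic polynomial at the tangent height x = 4 r,
    divided by 4 r^2. Its value 1 - a at r = 0 is negative, so it stays negative for small r >
    0.\<close>
  let ?f = "\<lambda>r. 1 - a + (14 * a - 2 - 11 * a\<^sup>2) * r + (1 + a) ^ 3 * r\<^sup>2"
  have "isCont ?f 0" by (intro continuous_intros)
  then have "(?f \<longlongrightarrow> ?f 0) (at_right 0)"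
    by (simp add: isCont_def filterlim_at_split)
  then have "eventually (\<lambda>r. ?f r < 0) (at_right 0)"
    by (rule order_tendstoD) (use assms in simp)
  moreover have "eventually (\<lambda>r::real. r \<in> {0<..<1}) (at_right 0)"
    by (rule eventually_at_right_real) simp
  ultimately have "eventually (\<lambda>r. ?f r < 0 \<and> r \<in> {0<..<1}) (at_right 0)"
    by eventually_elim simp
  then obtain r where r: "?f r < 0" "0 < r" "r < 1"
    using eventually_happens[of _ "at_right (0::real)"] by auto
  define t where "t = 1 - r"
  have t: "0 < t" "t < 1" "1 - t = r" using r by (auto simp: t_def)
  have "disc a t \<ge> 0" using disc_pos[of a t] t assms by simp
  from xbranch_quad[OF _ this, of "4 * r"] assms
  have "4 * a * (4 * r - xbranch a 1 t) * (4 * r - xbranch a (- 1) t)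
      = 4 * a * (4 * r)\<^sup>2 + 4 * r * (t\<^sup>2 - 20 * a * t * r - 8 * a\<^sup>2 * r\<^sup>2) - 4 * r * (t - a * r) ^ 3"
    unfolding t(3) by simp
  also have "\<dots> = 4 * r\<^sup>2 * ?f r"
    unfolding t_def by algebra
  also have "\<dots> < 0" using r by (simp add: mult_less_0_iff)
  finally have "(4 * r - xbranch a 1 t) * (4 * r - xbranch a (- 1) t) < 0"
    using assms by (simp add: mult_less_0_iff zero_less_mult_iff)
  moreover have "xbranch a (- 1) t \<le> xbranch a 1 t" using xbranch_le assms t by simp
  \<comment> \<open>A negative product places 4 r strictly between the two roots.\<close>
  ultimately have "4 * r < xbranch a 1 t" by (auto simp: mult_less_0_iff)
  then show ?thesis using that[of t] t by simp
qed

section \<open>The maximum of the upper curve\<close>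

text \<open>
  As a function of \<open>t\<close>, the quadratic polynomial at \<open>x = a + 1\<close> has a double root at
  \<open>t = 1 / (2 (a + 1))\<close> and no other real root.
\<close>
lemma xbranch_quad_max:
  assumes "a > 0" "disc a t \<ge> 0"
  shows "4 * a * (1 + a) * ((a + 1 - xbranch a 1 t) * (a + 1 - xbranch a (- 1) t))
    = (2 * (1 + a) * t - 1)\<^sup>2 * ((t - a * (1 - t) - a)\<^sup>2 + 4 * a)"
  using xbranch_quad[OF assms, of "a + 1"] by algebra

text \<open>The lower root is at most the mean of the roots, and 4 a times their sum is at most 8
  a^2 + 5 a. This makes the second factor in \<open>xbranch_quad_max\<close> positive, so the bound
  and the equality case there concern the upper root.\<close>

lemma xbranch_lower_less:
  assumes "a > 0" "0 \<le> t" "t \<le> 1"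
  shows "xbranch a (- 1) t < a + 1"
proof -
  have "4 * (t * (1 - t)) \<le> 1"
    using zero_le_power2[of "2 * t - 1"] by (simp add: power2_eq_square algebra_simps)
  from mult_left_mono[OF this, of "5 * a"] assms(1)
  have 1: "20 * a * t * (1 - t) \<le> 5 * a" by (simp add: mult_ac)
  have "(1 - t)\<^sup>2 \<le> 1" using assms by (simp add: abs_square_le_1)
  from mult_left_mono[OF this, of "8 * a\<^sup>2"] have 2: "8 * a\<^sup>2 * (1 - t)\<^sup>2 \<le> 8 * a\<^sup>2" by simp
  have "8 * a * xbranch a (- 1) t \<le> 4 * a * (xbranch a 1 t + xbranch a (- 1) t)"
    using mult_left_mono[OF xbranch_le[OF assms], of "4 * a"] assms(1) by (simp add: algebra_simps)
  also have "\<dots> < 8 * a\<^sup>2 + 8 * a"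
    unfolding xbranch_sum[OF assms(1)] using 1 2 assms(1) zero_le_power2[of t] by linarith
  also have "\<dots> = 8 * a * (a + 1)" by (simp add: power2_eq_square algebra_simps)
  finally show ?thesis using assms(1) by simp
qed

lemma xbranch_upper_le:
  assumes "a > 0" "0 \<le> t" "t \<le> 1"
  shows "xbranch a 1 t \<le> a + 1"
proof -
  have "disc a t \<ge> 0" using assms by (simp add: disc_def)
  then have "4 * a * (1 + a) * 0 \<le> 4 * a * (1 + a) * ((a + 1 - xbranch a 1 t) * (a + 1 - xbranch a (- 1) t))"
    unfolding xbranch_quad_max[OF assms(1) \<open>disc a t \<ge> 0\<close>] using assms(1) by simp
  then have "0 \<le> (a + 1 - xbranch a 1 t) * (a + 1 - xbranch a (- 1) t)"
    by (rule mult_left_le_imp_le) (use assms(1) in simp)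
  then show ?thesis using xbranch_lower_less[OF assms] by (simp add: zero_le_mult_iff)
qed

lemma xbranch_upper_max:
  assumes "a > 0"
  shows "xbranch a 1 (1 / (2 * (1 + a))) = a + 1"
proof -
  let ?t = "1 / (2 * (1 + a))"
  have t: "0 \<le> ?t" "?t \<le> 1" "2 * (1 + a) * ?t = 1" using assms by auto
  have "disc a ?t \<ge> 0" using disc_pos[of a ?t] t assms by simp
  from xbranch_quad_max[OF assms this]
  have "4 * a * (1 + a) * ((a + 1 - xbranch a 1 ?t) * (a + 1 - xbranch a (- 1) ?t)) = 0"
    unfolding t(3) by simp
  then show ?thesis using xbranch_lower_less[OF assms t(1,2)] assms by simp
qed

section \<open>Assembly of the four statements\<close>

theorem corollary2p5:
  fixes a :: real
  assumes "a > 0"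
  shows
    "((\<forall>t\<in>{0..1}. (t < tstar a \<longrightarrow> p_plus a t > 0) \<and> (t \<ge> tstar a \<longrightarrow> p_plus a t = 0))
      \<and> (\<forall>\<^sub>F t in nhds (tstar a).
          p_plus a field_differentiable (at t) \<and> deriv (p_plus a) field_differentiable (at t))
      \<and> isCont (deriv (p_plus a)) (tstar a)
      \<and> isCont (deriv (deriv (p_plus a))) (tstar a))
     \<and> (q_branch a has_real_derivative -4) (at 1 within {0..1})
     \<and> ((a \<le> 1 \<longrightarrow> concave_on {0..1} (q_branch a))
      \<and> (a > 1 \<longrightarrow> \<not> concave_on {0..1} (q_branch a)))
     \<and> ((\<exists>t\<in>{0..1}. q_branch a t = a + 1) \<and> (\<forall>t\<in>{0..1}. q_branch a t \<le> a + 1))"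
proof (intro conjI)
  note q = branches_eq_xbranch(1)[OF assms]
  \<comment> \<open>The sign change of the lower root at \<open>tstar a\<close> turns the maximum
    with 0 into a cut-off at that point.\<close>
  have p: "p_plus a t = left_part (tstar a) (xbranch a (- 1)) t" if "t \<in> {0..1}" for t
    using xbranch_signs(1,2)[OF assms, of t] branches_eq_xbranch(2)[OF assms that] that
    by (auto simp: p_plus_def left_part_def not_less)
  show "\<forall>t\<in>{0..1}. (t < tstar a \<longrightarrow> p_plus a t > 0) \<and> (t \<ge> tstar a \<longrightarrow> p_plus a t = 0)"
    using p xbranch_signs(1)[OF assms] by (auto simp: left_part_def)
  have ts: "tstar a \<in> {0<..<1}" using assms by (simp add: tstar_def)
  have "sqcurv a field_differentiable at (tstar a)"
    using sqcurv_deriv[of a "tstar a"] disc_pos[of a "tstar a"] ts assms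
    by (auto simp: field_differentiable_def)
  then have "isCont (sqcurv a) (tstar a)"
    by (rule field_differentiable_imp_continuous_at)
  then have cont: "isCont (xbranch'' a (- 1)) (tstar a)"
    unfolding xbranch''_def[abs_def] using assms by (intro continuous_intros) auto
  \<comment> \<open>The open unit interval serves as the neighbourhood of \<open>tstar a\<close>:
    there \<open>disc a\<close> is positive and \<open>p_plus a\<close> is the cut-off lower
    branch.\<close>
  note C2 = left_part_C2[of "{0<..<1}" "tstar a" "p_plus a", OF _ ts p
      xbranch_deriv xbranch'_deriv cont xbranch_signs(3) xbranch_derivs_tstar]
  show "\<forall>\<^sub>F t in nhds (tstar a).
      p_plus a field_differentiable (at t) \<and> deriv (p_plus a) field_differentiable (at t)"
    "isCont (deriv (p_plus a)) (tstar a)" "isCont (deriv (deriv (p_plus a))) (tstar a)"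
    by (rule C2; use assms ts disc_pos in auto)+
  show "(q_branch a has_real_derivative -4) (at 1 within {0..1})"
    by (rule has_field_derivative_transform_within[where d = 1 and f = "xbranch a 1"])
      (auto intro: xbranch_upper_deriv_1 assms DERIV_subset simp: q)
  \<comment> \<open>Convex combinations of points of the interval stay in it, so agreement on the
    interval suffices to transfer concavity.\<close>
  have conc: "concave_on {0..1} (q_branch a) \<longleftrightarrow> concave_on {0..1} (xbranch a 1)"
    using q convexD[of "{0..1::real}"] by (auto simp: concave_on_iff)
  show "a \<le> 1 \<longrightarrow> concave_on {0..1} (q_branch a)"
    using conc xbranch_upper_concave assms by blast
  show "a > 1 \<longrightarrow> \<not> concave_on {0..1} (q_branch a)"
  proof (intro impI notI)
    assume "a > 1" "concave_on {0..1} (q_branch a)"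
    then have c: "concave_on {0..1} (xbranch a 1)" using conc by simp
    obtain t where t: "0 \<le> t" "t \<le> 1" "xbranch a 1 t > 4 * (1 - t)"
      using xbranch_upper_gt_tangent[OF \<open>a > 1\<close>] .
    have "(xbranch a 1 has_real_derivative - 4) (at 1 within {0..1})"
      using xbranch_upper_deriv_1[OF assms] by (rule DERIV_subset) simp
    \<comment> \<open>With value 0 and slope -4 at 1, the tangent is 4 (1 - t), which the curve
      exceeds at the chosen t.\<close>
    from concave_on_le_tangent[OF c this, of t] t xbranch_upper_1[OF assms]
    show False by simp
  qed
  show "\<exists>t\<in>{0..1}. q_branch a t = a + 1"
    by (rule bexI[of _ "1 / (2 * (1 + a))"]) (use xbranch_upper_max q assms in auto)
  show "\<forall>t\<in>{0..1}. q_branch a t \<le> a + 1"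
    using q xbranch_upper_le[OF assms] by simp
qed

end
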